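(* Let $G_1$ and $G_2$ be finite simple graphs with disjoint vertex sets, and let $G_1+G_2$ denote their join. Then $$\mathscr{D}_1(G_1+G_2) \le \mathscr{D}_1(G_1)\,\mathscr{D}_1(G_2) + \mathscr{D}_1(G_1) + \mathscr{D}_1(G_2)$$ and $$\mathscr{D}_2(G_1+G_2) \le \mathscr{D}_2(G_1) + \mathscr{D}_2(G_2) + 1.$$
   Context: All graphs are finite and simple. For a graph $G$ and a labelling $f: V(G)\to\{0,1\}$, the induced edge labelling is $\overline{f}(xy)=|f(x)-f(y)|$ for $xy\in E(G)$. For $i\in\{0,1\}$, $v_i(f)$ is the number of vertices with label $i$ and $e_i(f)$ is the number of edges with induced label $i$. Put $\Delta_v(f)=|v_0(f)-v_1(f)|$ and $\Delta_e(f)=|e_0(f)-e_1(f)|$. Define $$\mathscr{D}_1(G)=\min_{f}\{\Delta_v(f)+\Delta_e(f)\},\qquad \mathscr{D}_2(G)=\min_{f:\,\Delta_v(f)\le 1}\{\Delta_e(f)\},$$ where the first minimum is over all labellings $f:V(G)\to\{0,1\}$ and the second is over those with $\Delta_v(f)\le 1$. The join $G_1+G_2$ of graphs with disjoint vertex sets has vertex set $V(G_1)\cup V(G_2)$ and its edges are the edges of $G_1$, the edges of $G_2$, and all pairs $xy$ with $x\in V(G_1)$, $y\in V(G_2)$. *)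

theory Defs
  imports "Graph_Theory.Pair_Digraph" "HOL-Library.FuncSet"
begin

text \<open>
  A finite simple graph is a \<^locale>\<open>pair_graph\<close>: a finite, loop-free digraph with a symmetric set of
  arcs. Each edge is represented by two opposite arcs, so edges are counted below as unordered
  pairs \<open>{x, y}\<close>.
\<close>

definition graph_join :: "'a pair_pre_digraph \<Rightarrow> 'a pair_pre_digraph \<Rightarrow> 'a pair_pre_digraph" where
  "graph_join G H =
     \<lparr> pverts = pverts G \<union> pverts H,
       parcs = parcs G \<union> parcs H \<union> pverts G \<times> pverts H \<union> pverts H \<times> pverts G \<rparr>"

text \<open>Extensionality makes the set of labellings finite.\<close>

definition labellings :: "'a pair_pre_digraph \<Rightarrow> ('a \<Rightarrow> int) set" where
  "labellings G = pverts G \<rightarrow>\<^sub>E {0, 1}"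

definition induced_label :: "('a \<Rightarrow> int) \<Rightarrow> 'a \<Rightarrow> 'a \<Rightarrow> int" where
  "induced_label f x y = \<bar>f x - f y\<bar>"

definition vertex_count :: "'a pair_pre_digraph \<Rightarrow> ('a \<Rightarrow> int) \<Rightarrow> int \<Rightarrow> nat" where
  "vertex_count G f i = card {x \<in> pverts G. f x = i}"

definition edge_count :: "'a pair_pre_digraph \<Rightarrow> ('a \<Rightarrow> int) \<Rightarrow> int \<Rightarrow> nat" where
  "edge_count G f i = card {{x, y} | x y. (x, y) \<in> parcs G \<and> induced_label f x y = i}"

definition Delta_v :: "'a pair_pre_digraph \<Rightarrow> ('a \<Rightarrow> int) \<Rightarrow> int" where
  "Delta_v G f = \<bar>int (vertex_count G f 0) - int (vertex_count G f 1)\<bar>"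

definition Delta_e :: "'a pair_pre_digraph \<Rightarrow> ('a \<Rightarrow> int) \<Rightarrow> int" where
  "Delta_e G f = \<bar>int (edge_count G f 0) - int (edge_count G f 1)\<bar>"

definition D1 :: "'a pair_pre_digraph \<Rightarrow> int" where
  "D1 G = Min {Delta_v G f + Delta_e G f | f. f \<in> labellings G}"

definition D2 :: "'a pair_pre_digraph \<Rightarrow> int" where
  "D2 G = Min {Delta_e G f | f. f \<in> labellings G \<and> Delta_v G f \<le> 1}"

lemma pair_graph_graph_join:
  assumes "pair_graph G" "pair_graph H" "pverts G \<inter> pverts H = {}"
  shows "pair_graph (graph_join G H)"
proof -
  interpret G: pair_graph G by fact
  interpret H: pair_graph H by fact
  have sG: "(y, x) \<in> parcs G" if "(x, y) \<in> parcs G" for x y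
    using G.arcs_symmetric that by blast
  have sH: "(y, x) \<in> parcs H" if "(x, y) \<in> parcs H" for x y
    using H.arcs_symmetric that by blast
  show ?thesis
    using assms(3) sG sH G.in_arcsD1 G.in_arcsD2 H.in_arcsD1 H.in_arcsD2
      G.no_loops' H.no_loops'
    by unfold_locales (auto simp: graph_join_def sym_def symmetric_def)
qed

text \<open>The sets minimised over in \<^const>\<open>D1\<close> and \<^const>\<open>D2\<close> are finite and nonempty.\<close>

lemma finite_labellings: "pair_graph G \<Longrightarrow> finite (labellings G)"
  unfolding labellings_def
  by (intro finite_PiE)
    (auto dest!: pair_graph.axioms(1) pair_digraph.axioms(1) pair_fin_digraph.pair_finite_verts)

lemma balanced_labelling_exists:
  assumes "finite (pverts G)"
  shows "\<exists>f \<in> labellings G. Delta_v G f \<le> 1"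
proof -
  obtain A where A: "A \<subseteq> pverts G" "card A = card (pverts G) div 2"
    using obtain_subset_with_card_n[of "card (pverts G) div 2" "pverts G"] by auto
  define f where "f = (\<lambda>x. if x \<in> pverts G then if x \<in> A then 1 else 0 else undefined :: int)"
  have "{x \<in> pverts G. f x = 1} = A" "{x \<in> pverts G. f x = 0} = pverts G - A"
    using A by (auto simp: f_def)
  moreover have "card (pverts G - A) = card (pverts G) - card (pverts G) div 2"
    using A assms by (simp add: card_Diff_subset finite_subset)
  ultimately have "Delta_v G f \<le> 1"
    using A by (simp add: Delta_v_def vertex_count_def)
  moreover have "f \<in> labellings G" by (auto simp: labellings_def f_def split: if_splits)
  ultimately show ?thesis by blast
qed

end

theory Submission
  imports Defs
begin

text \<open>
  Everything follows from keeping the signs of the differences whose absolute values are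
  \<^const>\<open>Delta_v\<close> and \<^const>\<open>Delta_e\<close>. Write \<open>p\<close> for the number of vertices labelled \<open>0\<close> minus
  the number labelled \<open>1\<close>, and \<open>q\<close> for the analogous difference on edges. If a labelling of the
  join restricts to labellings of the two parts with differences \<open>p\<^sub>1, q\<^sub>1\<close> and \<open>p\<^sub>2, q\<^sub>2\<close>, then the
  join has \<open>p = p\<^sub>1 + p\<^sub>2\<close> and \<open>q = q\<^sub>1 + q\<^sub>2 + p\<^sub>1 p\<^sub>2\<close>. Indeed, giving the labels \<open>0\<close> and \<open>1\<close> the
  signs \<open>1\<close> and \<open>-1\<close> turns the induced label of an edge into the product of the signs of its ends,
  so that the edges between the parts contribute the product of the two sign sums
  (\<open>edge_excess_graph_join\<close>).

  For the first bound, glue two optimal labellings: by the triangle inequality the cost is at most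
  \<open>\<bar>p\<^sub>1\<bar> + \<bar>q\<^sub>1\<bar> + \<bar>p\<^sub>2\<bar> + \<bar>q\<^sub>2\<bar> + \<bar>p\<^sub>1\<bar> \<bar>p\<^sub>2\<bar>\<close>, and each \<open>\<bar>p\<^sub>i\<bar>\<close> is at most the optimal cost of its part.

  For the second bound, glue two optimal balanced labellings. Here \<open>\<bar>p\<^sub>1 p\<^sub>2\<bar> \<le> 1\<close>, which is the
  extra \<open>1\<close>. The glued labelling is unbalanced only if \<open>p\<^sub>1 = p\<^sub>2 = \<plusminus>1\<close>, and then exchanging the two
  labels on the second part negates \<open>p\<^sub>2\<close> without changing \<open>q\<^sub>2\<close>.
\<close>

section \<open>Signed differences of label counts\<close>

definition vertex_excess :: "'a pair_pre_digraph \<Rightarrow> ('a \<Rightarrow> int) \<Rightarrow> int" where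
  "vertex_excess G f = int (vertex_count G f 0) - int (vertex_count G f 1)"

definition edge_excess :: "'a pair_pre_digraph \<Rightarrow> ('a \<Rightarrow> int) \<Rightarrow> int" where
  "edge_excess G f = int (edge_count G f 0) - int (edge_count G f 1)"

lemma Delta_v_eq: "Delta_v G f = \<bar>vertex_excess G f\<bar>"
  by (simp add: Delta_v_def vertex_excess_def)

lemma Delta_e_eq: "Delta_e G f = \<bar>edge_excess G f\<bar>"
  by (simp add: Delta_e_def edge_excess_def)

lemma vertex_count_cong:
  assumes "\<And>x. x \<in> pverts G \<Longrightarrow> f x = g x"
  shows "vertex_count G f i = vertex_count G g i"
  unfolding vertex_count_def using assms by (intro arg_cong[where f = card]) auto

lemma edge_count_cong:
  assumes "pair_graph G" and "\<And>x. x \<in> pverts G \<Longrightarrow> f x = g x"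
  shows "edge_count G f i = edge_count G g i"
proof -
  interpret pair_graph G by fact
  have "(x, y) \<in> parcs G \<and> induced_label f x y = i
      \<longleftrightarrow> (x, y) \<in> parcs G \<and> induced_label g x y = i" for x y
    using in_arcsD1[of x y] in_arcsD2[of x y] by (auto simp: induced_label_def assms(2))
  then show ?thesis by (simp only: edge_count_def)
qed

section \<open>Labellings of a join\<close>

lemma vertex_excess_graph_join:
  assumes "pair_graph G" "pair_graph H" and disj: "pverts G \<inter> pverts H = {}"
  shows "vertex_excess (graph_join G H) f = vertex_excess G f + vertex_excess H f"
proof -
  interpret G: pair_graph G by fact
  interpret H: pair_graph H by fact
  have "vertex_count (graph_join G H) f i = vertex_count G f i + vertex_count H f i" for i
  proof -
    have "{x \<in> pverts (graph_join G H). f x = i}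
        = {x \<in> pverts G. f x = i} \<union> {x \<in> pverts H. f x = i}"
      by (auto simp: graph_join_def)
    then show ?thesis
      unfolding vertex_count_def using disj by (simp add: card_Un_disjoint disjoint_iff)
  qed
  then show ?thesis by (simp add: vertex_excess_def)
qed

text \<open>
  An edge between the parts, unlike an edge inside a part, has only one orientation from the first
  part to the second, so these edges can be counted as ordered pairs.
\<close>

lemma card_cross_edges:
  assumes "A \<inter> B = {}"
  shows "card {{x, y} | x y. x \<in> A \<and> y \<in> B \<and> P x y} = card {(x, y) \<in> A \<times> B. P x y}"
proof -
  have inj: "inj_on (\<lambda>(x, y). {x, y}) {(x, y) \<in> A \<times> B. P x y}"
    using assms by (auto simp: inj_on_def doubleton_eq_iff)
  have "(\<lambda>(x, y). {x, y}) ` {(x, y) \<in> A \<times> B. P x y}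
      = {{x, y} | x y. x \<in> A \<and> y \<in> B \<and> P x y}"
    by force
  then show ?thesis using card_image[OF inj] by simp
qed

lemma edge_count_graph_join:
  assumes "pair_graph G" "pair_graph H" and disj: "pverts G \<inter> pverts H = {}"
  shows "edge_count (graph_join G H) f i = edge_count G f i + edge_count H f i
    + card {(x, y) \<in> pverts G \<times> pverts H. induced_label f x y = i}"
proof -
  interpret G: pair_graph G by fact
  interpret H: pair_graph H by fact
  define E where "E K = {{x, y} | x y. (x, y) \<in> parcs K \<and> induced_label f x y = i}"
    for K :: "'a pair_pre_digraph"
  define C where
    "C = {{x, y} | x y. x \<in> pverts G \<and> y \<in> pverts H \<and> induced_label f x y = i}"
  have E_join: "E (graph_join G H) = E G \<union> E H \<union> C"
  proof (intro equalityI subsetI)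
    fix e assume "e \<in> E (graph_join G H)"
    then obtain x y where e: "e = {x, y}" "(x, y) \<in> parcs (graph_join G H)"
      "induced_label f x y = i"
      unfolding E_def by blast
    moreover have "e = {y, x}" "induced_label f y x = i"
      using e by (auto simp: induced_label_def)
    ultimately show "e \<in> E G \<union> E H \<union> C"
      unfolding graph_join_def E_def C_def by auto
  next
    fix e assume "e \<in> E G \<union> E H \<union> C"
    then show "e \<in> E (graph_join G H)"
      unfolding graph_join_def E_def C_def by auto
  qed
  have G_sub: "e \<subseteq> pverts G" "e \<noteq> {}" if "e \<in> E G" for e
    using that G.in_arcsD1 G.in_arcsD2 by (auto simp: E_def)
  have H_sub: "e \<subseteq> pverts H" if "e \<in> E H" for e
    using that H.in_arcsD1 H.in_arcsD2 by (auto simp: E_def)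
  have C_sub: "e \<subseteq> pverts G \<union> pverts H" "\<not> e \<subseteq> pverts G" "\<not> e \<subseteq> pverts H"
    if "e \<in> C" for e
    using that disj by (auto simp: C_def)
  have "E G \<subseteq> Pow (pverts G)" "E H \<subseteq> Pow (pverts H)" "C \<subseteq> Pow (pverts G \<union> pverts H)"
    using G_sub(1) H_sub C_sub(1) by (simp_all add: subset_iff)
  then have "finite (E G)" "finite (E H)" "finite C"
    by (simp_all add: finite_subset)
  moreover have "E G \<inter> E H = {}"
    unfolding disjoint_iff by (metis G_sub H_sub disj Int_greatest subset_empty)
  moreover have "(E G \<union> E H) \<inter> C = {}"
    unfolding disjoint_iff Un_iff by (meson G_sub(1) H_sub C_sub(2,3))
  ultimately have "card (E (graph_join G H)) = card (E G) + card (E H) + card C"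
    by (simp add: E_join card_Un_disjoint)
  then show ?thesis
    unfolding edge_count_def E_def C_def card_cross_edges[OF disj] .
qed

text \<open>
  With \<open>a\<^sub>i\<close> and \<open>b\<^sub>i\<close> vertices labelled \<open>i\<close> in the two parts, \<open>a\<^sub>0 b\<^sub>0 + a\<^sub>1 b\<^sub>1\<close> edges between them
  are labelled \<open>0\<close> and \<open>a\<^sub>0 b\<^sub>1 + a\<^sub>1 b\<^sub>0\<close> are labelled \<open>1\<close>, a difference of
  \<open>(a\<^sub>0 - a\<^sub>1) (b\<^sub>0 - b\<^sub>1)\<close>.
\<close>

lemma edge_excess_graph_join:
  assumes "pair_graph G" "pair_graph H" and disj: "pverts G \<inter> pverts H = {}"
    and f: "f ` (pverts G \<union> pverts H) \<subseteq> {0, 1}"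
  shows "edge_excess (graph_join G H) f
    = edge_excess G f + edge_excess H f + vertex_excess G f * vertex_excess H f"
proof -
  interpret G: pair_graph G by fact
  interpret H: pair_graph H by fact
  define A where "A i = {x \<in> pverts G. f x = i}" for i
  define B where "B i = {x \<in> pverts H. f x = i}" for i
  have fin: "finite (A i)" "finite (B i)" for i
    by (simp_all add: A_def B_def)
  have VG: "pverts G = A 0 \<union> A 1" and VH: "pverts H = B 0 \<union> B 1"
    using f by (auto simp: A_def B_def)
  have "{(x, y) \<in> pverts G \<times> pverts H. induced_label f x y = 0} = A 0 \<times> B 0 \<union> A 1 \<times> B 1"
    unfolding VG VH by (auto simp: A_def B_def induced_label_def)
  moreover have "card (A 0 \<times> B 0 \<union> A 1 \<times> B 1) = card (A 0) * card (B 0) + card (A 1) * card (B 1)"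
    using fin by (subst card_Un_disjoint) (auto simp: A_def card_cartesian_product)
  moreover have
    "{(x, y) \<in> pverts G \<times> pverts H. induced_label f x y = 1} = A 0 \<times> B 1 \<union> A 1 \<times> B 0"
    unfolding VG VH by (auto simp: A_def B_def induced_label_def)
  moreover have "card (A 0 \<times> B 1 \<union> A 1 \<times> B 0) = card (A 0) * card (B 1) + card (A 1) * card (B 0)"
    using fin by (subst card_Un_disjoint) (auto simp: A_def card_cartesian_product)
  ultimately show ?thesis
    by (simp add: edge_excess_def vertex_excess_def edge_count_graph_join[OF assms(1-3)]
        vertex_count_def A_def[symmetric] B_def[symmetric] algebra_simps)
qed

lemma glued_labelling_exists:
  assumes "pair_graph G" "pair_graph H" and disj: "pverts G \<inter> pverts H = {}"
    and f: "f \<in> labellings G" and g: "g \<in> labellings H"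
  obtains h where "h \<in> labellings (graph_join G H)"
    and "vertex_excess (graph_join G H) h = vertex_excess G f + vertex_excess H g"
    and "edge_excess (graph_join G H) h
      = edge_excess G f + edge_excess H g + vertex_excess G f * vertex_excess H g"
proof
  define h where
    "h = restrict (\<lambda>x. if x \<in> pverts G then f x else g x) (pverts G \<union> pverts H)"
  have hG: "h x = f x" if "x \<in> pverts G" for x
    using that by (simp add: h_def)
  have hH: "h x = g x" if "x \<in> pverts H" for x
    using that disj by (auto simp: h_def)
  have img: "h ` (pverts G \<union> pverts H) \<subseteq> {0, 1}"
    using f g by (force simp: labellings_def hG hH)
  then show "h \<in> labellings (graph_join G H)"
    by (auto simp: labellings_def graph_join_def PiE_iff h_def)
  have "vertex_excess G h = vertex_excess G f" "vertex_excess H h = vertex_excess H g"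
    using hG hH vertex_count_cong unfolding vertex_excess_def by metis+
  moreover have "edge_excess G h = edge_excess G f" "edge_excess H h = edge_excess H g"
    using hG hH edge_count_cong[OF assms(1)] edge_count_cong[OF assms(2)]
    unfolding edge_excess_def by metis+
  ultimately show
    "vertex_excess (graph_join G H) h = vertex_excess G f + vertex_excess H g"
    "edge_excess (graph_join G H) h
      = edge_excess G f + edge_excess H g + vertex_excess G f * vertex_excess H g"
    using vertex_excess_graph_join[OF assms(1-3)] edge_excess_graph_join[OF assms(1-3) img]
    by simp_all
qed

section \<open>Exchanging the two labels\<close>

text \<open>Only the difference of the end labels matters for an edge, and only up to sign.\<close>

lemma flipped_labelling_exists:
  assumes "pair_graph G" and f: "f \<in> labellings G"
  obtains g where "g \<in> labellings G"
    and "vertex_excess G g = - vertex_excess G f" and "edge_excess G g = edge_excess G f"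
proof
  define g where "g = restrict (\<lambda>x. 1 - f x) (pverts G)"
  have g: "g x = 1 - f x" if "x \<in> pverts G" for x
    using that by (simp add: g_def)
  show "g \<in> labellings G"
    using f by (force simp: labellings_def PiE_iff g_def)
  have "{x \<in> pverts G. g x = 0} = {x \<in> pverts G. f x = 1}"
    "{x \<in> pverts G. g x = 1} = {x \<in> pverts G. f x = 0}"
    by (auto simp: g)
  then show "vertex_excess G g = - vertex_excess G f"
    by (simp add: vertex_excess_def vertex_count_def)
  have "edge_count G g i = edge_count G (\<lambda>x. 1 - f x) i" for i
    using g by (rule edge_count_cong[OF assms(1)])
  moreover have "induced_label (\<lambda>x. 1 - f x) = induced_label f"
    by (intro ext) (simp add: induced_label_def)
  ultimately show "edge_excess G g = edge_excess G f"
    by (simp add: edge_excess_def edge_count_def)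
qed

section \<open>Optimal labellings\<close>

lemma D1_le:
  assumes "pair_graph G" "f \<in> labellings G"
  shows "D1 G \<le> Delta_v G f + Delta_e G f"
  unfolding D1_def using assms finite_labellings[OF assms(1)] by (auto intro!: Min_le)

lemma D2_le:
  assumes "pair_graph G" "f \<in> labellings G" "Delta_v G f \<le> 1"
  shows "D2 G \<le> Delta_e G f"
  unfolding D2_def using assms finite_labellings[OF assms(1)] by (auto intro!: Min_le)

lemma D2_attained:
  assumes "pair_graph G"
  obtains f where "f \<in> labellings G" "Delta_v G f \<le> 1" "D2 G = Delta_e G f"
proof -
  interpret pair_graph G by fact
  let ?S = "{Delta_e G f | f. f \<in> labellings G \<and> Delta_v G f \<le> 1}"
  have "finite ?S" using finite_labellings[OF assms] by simp
  moreover have "?S \<noteq> {}" using balanced_labelling_exists[of G] by auto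
  ultimately have "D2 G \<in> ?S" unfolding D2_def by (rule Min_in)
  then show ?thesis using that by blast
qed

lemma D1_attained:
  assumes "pair_graph G"
  obtains f where "f \<in> labellings G" "D1 G = Delta_v G f + Delta_e G f"
proof -
  interpret pair_graph G by fact
  let ?S = "{Delta_v G f + Delta_e G f | f. f \<in> labellings G}"
  have "finite ?S" using finite_labellings[OF assms] by simp
  moreover have "?S \<noteq> {}" using balanced_labelling_exists[of G] by auto
  ultimately have "D1 G \<in> ?S" unfolding D1_def by (rule Min_in)
  then show ?thesis using that by blast
qed

section \<open>The bounds for the join\<close>

lemma D1_graph_join_le:
  assumes "pair_graph G" "pair_graph H" "pverts G \<inter> pverts H = {}"
  shows "D1 (graph_join G H) \<le> D1 G * D1 H + D1 G + D1 H"
proof -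
  obtain f where f: "f \<in> labellings G" "D1 G = Delta_v G f + Delta_e G f"
    using D1_attained[OF assms(1)] .
  obtain g where g: "g \<in> labellings H" "D1 H = Delta_v H g + Delta_e H g"
    using D1_attained[OF assms(2)] .
  obtain h where h: "h \<in> labellings (graph_join G H)"
    "vertex_excess (graph_join G H) h = vertex_excess G f + vertex_excess H g"
    "edge_excess (graph_join G H) h
      = edge_excess G f + edge_excess H g + vertex_excess G f * vertex_excess H g"
    using glued_labelling_exists[OF assms f(1) g(1)] .
  have "D1 (graph_join G H)
      \<le> \<bar>vertex_excess (graph_join G H) h\<bar> + \<bar>edge_excess (graph_join G H) h\<bar>"
    using D1_le[OF pair_graph_graph_join[OF assms] h(1)] by (simp add: Delta_v_eq Delta_e_eq)
  also have "\<dots> \<le> D1 G + D1 H + \<bar>vertex_excess G f * vertex_excess H g\<bar>"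
    unfolding h f g Delta_v_eq Delta_e_eq by linarith
  also have "\<bar>vertex_excess G f * vertex_excess H g\<bar> \<le> D1 G * D1 H"
    unfolding f g Delta_v_eq Delta_e_eq abs_mult by (intro mult_mono) auto
  finally show ?thesis by simp
qed

lemma D2_graph_join_le:
  assumes "pair_graph G" "pair_graph H" "pverts G \<inter> pverts H = {}"
  shows "D2 (graph_join G H) \<le> D2 G + D2 H + 1"
proof -
  obtain f where f: "f \<in> labellings G" "Delta_v G f \<le> 1" "D2 G = Delta_e G f"
    using D2_attained[OF assms(1)] .
  obtain g where g: "g \<in> labellings H" "\<bar>vertex_excess H g\<bar> \<le> 1" "D2 H = \<bar>edge_excess H g\<bar>"
    "\<bar>vertex_excess G f + vertex_excess H g\<bar> \<le> 1"
  proof -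
    obtain g where g: "g \<in> labellings H" "Delta_v H g \<le> 1" "D2 H = Delta_e H g"
      using D2_attained[OF assms(2)] .
    obtain g' where g': "g' \<in> labellings H"
      "vertex_excess H g' = - vertex_excess H g" "edge_excess H g' = edge_excess H g"
      using flipped_labelling_exists[OF assms(2) g(1)] .
    have "\<bar>vertex_excess G f + vertex_excess H g\<bar> \<le> 1
        \<or> \<bar>vertex_excess G f + vertex_excess H g'\<bar> \<le> 1"
      using f(2) g(2) g'(2) unfolding Delta_v_eq by linarith
    then show ?thesis using that g g' by (auto simp: Delta_v_eq Delta_e_eq)
  qed
  obtain h where h: "h \<in> labellings (graph_join G H)"
    "vertex_excess (graph_join G H) h = vertex_excess G f + vertex_excess H g"
    "edge_excess (graph_join G H) h
      = edge_excess G f + edge_excess H g + vertex_excess G f * vertex_excess H g"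
    using glued_labelling_exists[OF assms f(1) g(1)] .
  have "\<bar>vertex_excess G f * vertex_excess H g\<bar> \<le> 1 * 1"
    unfolding abs_mult using f(2) g(2) by (intro mult_mono) (auto simp: Delta_v_eq)
  then have "\<bar>edge_excess (graph_join G H) h\<bar> \<le> D2 G + D2 H + 1"
    unfolding h f(3) g(3) Delta_e_eq by linarith
  moreover have "D2 (graph_join G H) \<le> \<bar>edge_excess (graph_join G H) h\<bar>"
    using D2_le[OF pair_graph_graph_join[OF assms] h(1)] g(4) h(2)
    by (simp add: Delta_v_eq Delta_e_eq)
  ultimately show ?thesis by linarith
qed

theorem theorem2p1:
  fixes G1 G2 :: "'a pair_pre_digraph"
  assumes "pair_graph G1" and "pair_graph G2"
    and "pverts G1 \<inter> pverts G2 = {}"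
  shows "D1 (graph_join G1 G2) \<le> D1 G1 * D1 G2 + D1 G1 + D1 G2
    \<and> D2 (graph_join G1 G2) \<le> D2 G1 + D2 G2 + 1"
  using D1_graph_join_le[OF assms] D2_graph_join_le[OF assms] by (rule conjI)

end
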